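(* Let the depth be reconstructed in cell $C_j$ with interface values $h_{j-1/2}^+,h_{j+1/2}^-$ by the convex-combination minmod reconstruction described in the context, let $h_j>0$, and let the volume flux be reconstructed with gradient $$[q_x]_j=\kappa_j\,\sigma(q_{j-1},q_j,q_{j+1};\{x\}),\qquad \kappa_j=\min\Big[1,\ \frac{K_{j-1/2}^+h_j}{h_{j-1}},\ \frac{K_{j+1/2}^-h_j}{h_{j+1}}\Big],$$ where $K_{j-1/2}^+,K_{j+1/2}^-$ are functions of $\{x\}$ with values in $(0,\infty)$ (and $1/0=+\infty$ in the ratios). Then the reconstructed velocities $u_{j-1/2}^+=q_{j-1/2}^+/h_{j-1/2}^+$ and $u_{j+1/2}^-=q_{j+1/2}^-/h_{j+1/2}^-$ satisfy $$|u_{j-1/2}^+|\le\frac{G_j+1}{1-\alpha_j^\uparrow}\big(|u_j|+K_{j-1/2}^+\alpha_{j-1/2}^+|u_{j-1}|\big),\qquad |u_{j+1/2}^-|\le\frac{G_j+1}{1-\alpha_j^\uparrow}\big(|u_j|+K_{j+1/2}^-\alpha_{j+1/2}^-|u_{j+1}|\big).$$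
   Context: Grid: $\{x\}=(x_{1/2}<x_{3/2}<\dots<x_{J+1/2})$, cells $C_j=(x_{j-1/2},x_{j+1/2})$, $\Delta x_j=x_{j+1/2}-x_{j-1/2}$; $j$ is a cell with neighbours $j-1,j+1$. Cell averages: depths $h_k\ge0$, volume fluxes $q_k$, velocities $u_k$ with $q_k=u_kh_k$ (so $u_k=q_k/h_k$ when $h_k>0$). The bed elevation has known values $b_{k-1/2}^+,b_{k+1/2}^-$ at the ends of each cell $C_k$, with $b_k=\frac12(b_{k-1/2}^++b_{k+1/2}^-)$, $\Delta b_k=b_{k+1/2}^--b_{k-1/2}^+$, $[b_x]_k=\Delta b_k/\Delta x_k$, and $\eta_k=h_k+b_k$. For any field $v$, $\Delta v_{k+1/2}=v_{k+1}-v_k$. Minmod: $\operatorname{minmod}[y_1,\dots,y_n]$ equals $\min_i y_i$ if $\min_i y_i>0$, $\max_i y_i$ if $\max_i y_i<0$, and $0$ otherwise. The slope limiter is $$\sigma(v_{j-1},v_j,v_{j+1};\{x\})=\frac{2}{\Delta x_j}\operatorname{minmod}\big[\alpha_{j-1/2}^{+}(v_j-v_{j-1}),\ \alpha_j(v_{j+1}-v_{j-1}),\ \alpha_{j+1/2}^{-}(v_{j+1}-v_j)\big],$$ with $\alpha_j,\alpha_{j-1/2}^+,\alpha_{j+1/2}^-$ functions of $\{x\}$ with values in $[0,1]$ (the same parameters for all fields); $\alpha_j^\uparrow=\max[\alpha_{j-1/2}^+,\alpha_{j+1/2}^-]$. Depth reconstruction: $[h_x]_j=(1-\gamma_j)\,\sigma(h_{j-1},h_j,h_{j+1};\{x\})+\gamma_j\,\big(\sigma(\eta_{j-1},\eta_j,\eta_{j+1};\{x\})-[b_x]_j\big)$.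 Here $0<G_j\le1-\alpha_j^\uparrow$ with $G_j$ a function of $\{x\}$, $\xi_j^C=1+1/G_j$, $\gamma_j=0$ if $\xi_j\le1$, $\gamma_j=G_j(\xi_j-1)$ if $1\le\xi_j\le\xi_j^C$, $\gamma_j=1$ if $\xi_j\ge\xi_j^C$; $\xi_j=h_j^\downarrow/\Delta b_j^\uparrow$ ($=+\infty$ if $\Delta b_j^\uparrow=0$); $h_j^\downarrow=\min[h_j-\alpha_{j-1/2}^+\Delta h_{j-1/2},\,h_j,\,h_j+\alpha_{j+1/2}^-\Delta h_{j+1/2}]$; and $\Delta b_j^\uparrow$ is independent of $\{h\}=(h_1,\dots,h_J)$ with $$\Delta b_j^\uparrow\ge\max\big[|\tfrac{\Delta b_j}{2}-\alpha_{j-1/2}^{+}\Delta b_{j-1/2}|,\,|\tfrac{\Delta b_j}{2}|,\,|\tfrac{\Delta b_j}{2}-\alpha_j(b_{j+1}-b_{j-1})|,\,|\tfrac{\Delta b_j}{2}-\alpha_{j+1/2}^{-}\Delta b_{j+1/2}|\big].$$ For $v=h,q$ the interface values are $v_{j-1/2}^+=v_j-\frac{\Delta x_j}{2}[v_x]_j$ and $v_{j+1/2}^-=v_j+\frac{\Delta x_j}{2}[v_x]_j$. *)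

theory Defs
  imports "HOL-Library.Extended_Real"
begin

text \<open>
  Indexing: a cell quantity \<open>v\<^sub>k\<close> is \<open>v k\<close>, and a quantity at the cell edge \<open>k + 1/2\<close> is stored at
  index \<open>k\<close>; so \<open>x k\<close> is the edge point \<open>x\<close> at \<open>k + 1/2\<close>, and cell \<open>k\<close> is the interval from
  \<open>x (k - 1)\<close> to \<open>x k\<close>.  Indices are integers, so that \<open>k - 1\<close> never truncates.  The suffixes
  \<open>p\<close> and \<open>m\<close> stand for the superscripts + and -: at an edge, + is the value on the right side of
  the edge (left end of a cell) and - the value on the left side (right end of a cell).
  Hence the limiter parameters of cell \<open>j\<close> are \<open>ap (j - 1)\<close>, \<open>ac j\<close>, \<open>am j\<close>, and the bed values
  at the two ends of cell \<open>k\<close> are \<open>bp (k - 1)\<close> and \<open>bm k\<close>.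
\<close>

definition cell_width :: "(int \<Rightarrow> real) \<Rightarrow> int \<Rightarrow> real" where
  "cell_width x k = x k - x (k - 1)"

text \<open>The difference across the edge \<open>k + 1/2\<close>.\<close>

definition jump :: "(int \<Rightarrow> real) \<Rightarrow> int \<Rightarrow> real" where
  "jump v k = v (k + 1) - v k"

definition minmod :: "real list \<Rightarrow> real" where
  "minmod ys =
     (if Min (set ys) > 0 then Min (set ys)
      else if Max (set ys) < 0 then Max (set ys)
      else 0)"

definition slope_limiter ::
  "(int \<Rightarrow> real) \<Rightarrow> (int \<Rightarrow> real) \<Rightarrow> (int \<Rightarrow> real) \<Rightarrow> (int \<Rightarrow> real) \<Rightarrow> (int \<Rightarrow> real) \<Rightarrow> int \<Rightarrow> real" where
  "slope_limiter x ap ac am v j =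
     2 / cell_width x j *
     minmod [ap (j - 1) * (v j - v (j - 1)),
             ac j * (v (j + 1) - v (j - 1)),
             am j * (v (j + 1) - v j)]"

definition alpha_up :: "(int \<Rightarrow> real) \<Rightarrow> (int \<Rightarrow> real) \<Rightarrow> int \<Rightarrow> real" where
  "alpha_up ap am j = max (ap (j - 1)) (am j)"

definition bed_mean :: "(int \<Rightarrow> real) \<Rightarrow> (int \<Rightarrow> real) \<Rightarrow> int \<Rightarrow> real" where
  "bed_mean bp bm k = (bp (k - 1) + bm k) / 2"

definition bed_step :: "(int \<Rightarrow> real) \<Rightarrow> (int \<Rightarrow> real) \<Rightarrow> int \<Rightarrow> real" where
  "bed_step bp bm k = bm k - bp (k - 1)"

definition bed_slope :: "(int \<Rightarrow> real) \<Rightarrow> (int \<Rightarrow> real) \<Rightarrow> (int \<Rightarrow> real) \<Rightarrow> int \<Rightarrow> real" where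
  "bed_slope x bp bm k = bed_step bp bm k / cell_width x k"

definition surface :: "(int \<Rightarrow> real) \<Rightarrow> (int \<Rightarrow> real) \<Rightarrow> (int \<Rightarrow> real) \<Rightarrow> int \<Rightarrow> real" where
  "surface bp bm h k = h k + bed_mean bp bm k"

text \<open>The lower bound imposed on the bed scale \<open>\<Delta>b\<^sub>j\<^sup>\<up>\<close>.\<close>

definition bed_variation ::
  "(int \<Rightarrow> real) \<Rightarrow> (int \<Rightarrow> real) \<Rightarrow> (int \<Rightarrow> real) \<Rightarrow> (int \<Rightarrow> real) \<Rightarrow> (int \<Rightarrow> real) \<Rightarrow> int \<Rightarrow> real" where
  "bed_variation ap ac am bp bm j =
     (let b = bed_mean bp bm; d = bed_step bp bm j / 2 in
      Max {\<bar>d - ap (j - 1) * jump b (j - 1)\<bar>,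
           \<bar>d\<bar>,
           \<bar>d - ac j * (b (j + 1) - b (j - 1))\<bar>,
           \<bar>d - am j * jump b j\<bar>})"

definition depth_down :: "(int \<Rightarrow> real) \<Rightarrow> (int \<Rightarrow> real) \<Rightarrow> (int \<Rightarrow> real) \<Rightarrow> int \<Rightarrow> real" where
  "depth_down ap am h j =
     Min {h j - ap (j - 1) * jump h (j - 1), h j, h j + am j * jump h j}"

text \<open>The case distinction is needed because \<open>0 / 0 = 0\<close> in \<^typ>\<open>ereal\<close>, whereas the ratio
  \<open>\<xi>\<^sub>j\<close> is \<open>+\<infinity>\<close> on a flat bed also when the numerator vanishes.\<close>

definition depth_bed_ratio :: "real \<Rightarrow> real \<Rightarrow> ereal" where
  "depth_bed_ratio hdown dbup = (if dbup = 0 then \<infinity> else ereal (hdown / dbup))"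

definition blend :: "real \<Rightarrow> ereal \<Rightarrow> real" where
  "blend G xi =
     (if xi \<le> 1 then 0
      else if xi \<le> ereal (1 + 1 / G) then G * (real_of_ereal xi - 1)
      else 1)"

definition depth_gradient ::
  "(int \<Rightarrow> real) \<Rightarrow> (int \<Rightarrow> real) \<Rightarrow> (int \<Rightarrow> real) \<Rightarrow> (int \<Rightarrow> real) \<Rightarrow>
   (int \<Rightarrow> real) \<Rightarrow> (int \<Rightarrow> real) \<Rightarrow> (int \<Rightarrow> real) \<Rightarrow> (int \<Rightarrow> real) \<Rightarrow> (int \<Rightarrow> real) \<Rightarrow> int \<Rightarrow> real" where
  "depth_gradient x ap ac am G bp bm dbup h j =
     (let \<gamma> = blend (G j) (depth_bed_ratio (depth_down ap am h j) (dbup j)) in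
      (1 - \<gamma>) * slope_limiter x ap ac am h j +
      \<gamma> * (slope_limiter x ap ac am (surface bp bm h) j - bed_slope x bp bm j))"

text \<open>The ratios are taken in \<^typ>\<open>ereal\<close>, where a positive number divided by \<open>0\<close> is \<open>\<infinity>\<close>; thus a dry
  neighbour imposes no restriction (in \<^typ>\<open>real\<close> the ratio would be \<open>0\<close>).\<close>

definition flux_factor :: "(int \<Rightarrow> real) \<Rightarrow> (int \<Rightarrow> real) \<Rightarrow> (int \<Rightarrow> real) \<Rightarrow> int \<Rightarrow> real" where
  "flux_factor Kp Km h j =
     real_of_ereal (Min {1,
       ereal (Kp (j - 1) * h j) / ereal (h (j - 1)),
       ereal (Km j * h j) / ereal (h (j + 1))})"

definition flux_gradient ::
  "(int \<Rightarrow> real) \<Rightarrow> (int \<Rightarrow> real) \<Rightarrow> (int \<Rightarrow> real) \<Rightarrow> (int \<Rightarrow> real) \<Rightarrow>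
   (int \<Rightarrow> real) \<Rightarrow> (int \<Rightarrow> real) \<Rightarrow> (int \<Rightarrow> real) \<Rightarrow> (int \<Rightarrow> real) \<Rightarrow> int \<Rightarrow> real" where
  "flux_gradient x ap ac am Kp Km h q j =
     flux_factor Kp Km h j * slope_limiter x ap ac am q j"

text \<open>Values at the left and right end of cell \<open>j\<close> of the linear reconstruction of \<open>v\<close> with
  gradient \<open>s\<close> in that cell.\<close>

definition left_value :: "(int \<Rightarrow> real) \<Rightarrow> (int \<Rightarrow> real) \<Rightarrow> real \<Rightarrow> int \<Rightarrow> real" where
  "left_value x v s j = v j - cell_width x j / 2 * s"

definition right_value :: "(int \<Rightarrow> real) \<Rightarrow> (int \<Rightarrow> real) \<Rightarrow> real \<Rightarrow> int \<Rightarrow> real" where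
  "right_value x v s j = v j + cell_width x j / 2 * s"

end

theory Submission
  imports Defs
begin

text \<open>
  The two factors of the bound come from two independent estimates, a lower bound for the
  reconstructed depths and an upper bound for the reconstructed fluxes.

  Depth.  A minmod value lies between 0 and each of its arguments, so the half-cell increment of
  the pure depth reconstruction keeps both end values above \<open>h\<^sub>j\<^sup>\<down>\<close>, and that of the
  surface-based reconstruction, which differs from it only by bed differences of size at most
  \<open>\<Delta>b\<^sub>j\<^sup>\<up>\<close>, keeps them above \<open>h\<^sub>j\<^sup>\<down> - \<Delta>b\<^sub>j\<^sup>\<up>\<close>.  The convex combination therefore stays above
  \<open>h\<^sub>j\<^sup>\<down> - \<gamma>\<^sub>j \<Delta>b\<^sub>j\<^sup>\<up>\<close>.  The blending weight is tuned so that \<open>\<gamma>\<^sub>j \<Delta>b\<^sub>j\<^sup>\<up>\<close> never exceeds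
  \<open>h\<^sub>j\<^sup>\<down> G\<^sub>j / (1 + G\<^sub>j)\<close>: for small bed scales because \<open>\<xi>\<^sub>j \<ge> 1 + 1 / G\<^sub>j\<close> says just that, and for
  larger ones because \<open>\<gamma>\<^sub>j \<Delta>b\<^sub>j\<^sup>\<up> = G\<^sub>j (h\<^sub>j\<^sup>\<down> - \<Delta>b\<^sub>j\<^sup>\<up>)\<close> decreases in the bed scale
  until the weight vanishes (lemma \<open>blend_times_bed_scale_le\<close>).  As the neighbouring depths are nonnegative,
  \<open>h\<^sub>j\<^sup>\<down> \<ge> (1 - \<alpha>\<^sub>j\<^sup>\<up>) h\<^sub>j\<close>, and so both end depths are at least
  \<open>(1 - \<alpha>\<^sub>j\<^sup>\<up>) h\<^sub>j / (1 + G\<^sub>j)\<close>, which is positive (lemma \<open>depth_end_values_ge\<close>).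

  Flux.  The end value lies between \<open>q\<^sub>j\<close> and a convex combination of \<open>q\<^sub>j\<close> and the
  neighbouring flux, in which the neighbour has weight \<open>\<kappa>\<^sub>j\<close> times its limiter parameter.  The
  factor \<open>\<kappa>\<^sub>j\<close> replaces the neighbour's depth in \<open>\<kappa>\<^sub>j |q\<^sub>j\<^sub>\<plusminus>\<^sub>1| = \<kappa>\<^sub>j h\<^sub>j\<^sub>\<plusminus>\<^sub>1 |u\<^sub>j\<^sub>\<plusminus>\<^sub>1|\<close> by a
  multiple of \<open>h\<^sub>j\<close>.  Thus the end flux is at most \<open>h\<^sub>j\<close> times a combination of velocities, and
  \<open>h\<^sub>j\<close> cancels in the quotient.
\<close>

lemma minmod_between_0_and_entry:
  assumes "y \<in> set ys"
  shows "min 0 y \<le> minmod ys" and "minmod ys \<le> max 0 y"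
proof -
  have "Min (set ys) \<le> y" "y \<le> Max (set ys)"
    using assms by simp_all
  then show "min 0 y \<le> minmod ys" "minmod ys \<le> max 0 y"
    unfolding minmod_def
    by (cases "Min (set ys) > 0"; cases "Max (set ys) < 0"; simp only: if_True if_False; linarith)+
qed

text \<open>\<open>m\<close> is the increment over half a cell, so that the end values are \<open>v j - m\<close> and \<open>v j + m\<close>.
  The bounds by the left difference put the left end value between \<open>v j\<close> and a point on the segment
  from \<open>v j\<close> to \<open>v (j - 1)\<close> when the parameter is at most 1; those by the right difference do the
  same at the right end.\<close>

lemma half_cell_increment_bounds:
  fixes x ap ac am v :: "int \<Rightarrow> real"
  assumes "0 < cell_width x j"
  defines "m \<equiv> cell_width x j / 2 * slope_limiter x ap ac am v j"
  shows "min 0 (ap (j - 1) * (v j - v (j - 1))) \<le> m"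
    and "m \<le> max 0 (ap (j - 1) * (v j - v (j - 1)))"
    and "min 0 (am j * (v (j + 1) - v j)) \<le> m"
    and "m \<le> max 0 (am j * (v (j + 1) - v j))"
proof -
  have m: "m = minmod [ap (j - 1) * (v j - v (j - 1)),
      ac j * (v (j + 1) - v (j - 1)), am j * (v (j + 1) - v j)]"
    using assms(1) by (simp add: m_def slope_limiter_def)
  show "min 0 (ap (j - 1) * (v j - v (j - 1))) \<le> m"
    and "m \<le> max 0 (ap (j - 1) * (v j - v (j - 1)))"
    and "min 0 (am j * (v (j + 1) - v j)) \<le> m"
    and "m \<le> max 0 (am j * (v (j + 1) - v j))"
    unfolding m by (intro minmod_between_0_and_entry; simp)+
qed

section \<open>Lower bound for the depth\<close>

text \<open>This is what the formula for the blending weight is designed for.  The two regimes meet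
  at the bed scale \<open>H G / (1 + G)\<close>, where the left-hand side attains its maximum.\<close>

lemma blend_times_bed_scale_le:
  assumes "0 < G" "0 \<le> d" "0 < H"
  shows "0 \<le> blend G (depth_bed_ratio H d)"
    and "blend G (depth_bed_ratio H d) \<le> 1"
    and "blend G (depth_bed_ratio H d) * d \<le> H * G / (1 + G)"
proof -
  let ?g = "blend G (depth_bed_ratio H d)"
  have "0 \<le> ?g \<and> ?g \<le> 1 \<and> ?g * d \<le> H * G / (1 + G)"
  proof (cases "d = 0")
    case True
    then show ?thesis
      using assms by (simp add: blend_def depth_bed_ratio_def)
  next
    case False
    then have d: "0 < d"
      using assms by simp
    have xi: "depth_bed_ratio H d = ereal (H / d)"
      using False by (simp add: depth_bed_ratio_def)
    consider (steep) "H / d \<le> 1" | (middle) "1 < H / d" "H / d \<le> 1 + 1 / G" | (flat) "1 + 1 / G < H / d"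
      by linarith
    then show ?thesis
    proof cases
      case steep
      then have "?g = 0"
        by (simp add: xi blend_def)
      then show ?thesis
        using assms by simp
    next
      case middle
      then have g: "?g = G * (H / d - 1)"
        by (simp add: xi blend_def)
      have "G * (H / d - 1) \<le> G * (1 / G)"
        using middle assms by (intro mult_left_mono) auto
      moreover have "?g * d \<le> H * G / (1 + G)"
      proof -
        have "H * G \<le> d * (1 + G)"
          using middle d assms by (simp add: field_simps)
        then have "G * (H * G) \<le> G * (d * (1 + G))"
          using assms by (intro mult_left_mono) auto
        then have "G * (H - d) * (1 + G) \<le> H * G"
          by (simp add: algebra_simps)
        moreover have "?g * d = G * (H - d)"
          using d by (simp add: g field_simps)
        ultimately show ?thesis
          using assms by (simp add: pos_le_divide_eq)
      qed
      ultimately show ?thesis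
        using middle assms g by simp
    next
      case flat
      moreover have "1 < H / d"
        using flat assms by (smt (verit) divide_pos_pos)
      ultimately have g: "?g = 1"
        by (simp add: xi blend_def)
      have "d * (1 + G) \<le> H * G"
        using flat d assms by (simp add: field_simps)
      then show ?thesis
        using assms by (simp add: g pos_le_divide_eq)
    qed
  qed
  then show "0 \<le> ?g" "?g \<le> 1" "?g * d \<le> H * G / (1 + G)"
    by auto
qed

lemma depth_down_le:
  "depth_down ap am h j \<le> h j - ap (j - 1) * (h j - h (j - 1))"
  "depth_down ap am h j \<le> h j"
  "depth_down ap am h j \<le> h j + am j * (h (j + 1) - h j)"
  by (simp_all add: depth_down_def jump_def)

lemma depth_down_ge:
  assumes "0 \<le> ap (j - 1)" "0 \<le> am j" "alpha_up ap am j \<le> 1"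
    and "0 \<le> h (j - 1)" "0 \<le> h j" "0 \<le> h (j + 1)"
  shows "(1 - alpha_up ap am j) * h j \<le> depth_down ap am h j"
proof -
  \<comment> \<open>The one-sided values are convex combinations of \<open>h j\<close> and a nonnegative depth.\<close>
  have *: "(1 - alpha_up ap am j) * h j \<le> h j - a * (h j - k)"
    if "0 \<le> a" "a \<le> alpha_up ap am j" "0 \<le> k" for a k
  proof -
    have "(1 - alpha_up ap am j) * h j \<le> (1 - a) * h j"
      using that assms by (intro mult_right_mono) auto
    moreover have "0 \<le> a * k"
      using that by simp
    ultimately show ?thesis
      by (simp add: algebra_simps)
  qed
  have "(1 - alpha_up ap am j) * h j \<le> h j - ap (j - 1) * (h j - h (j - 1))"
    using assms by (intro *) (auto simp: alpha_up_def)
  moreover have "(1 - alpha_up ap am j) * h j \<le> h j - am j * (h j - h (j + 1))"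
    using assms by (intro *) (auto simp: alpha_up_def)
  moreover have "(1 - alpha_up ap am j) * h j \<le> h j - 0 * (h j - h j)"
    using assms by (intro *) (auto simp: alpha_up_def)
  ultimately show ?thesis
    by (simp add: depth_down_def jump_def algebra_simps)
qed

lemma abs_le_bed_variation:
  fixes ap ac am bp bm :: "int \<Rightarrow> real"
  defines "b \<equiv> bed_mean bp bm"
  shows "\<bar>bed_step bp bm j / 2 - ap (j - 1) * (b j - b (j - 1))\<bar> \<le> bed_variation ap ac am bp bm j"
    and "\<bar>bed_step bp bm j / 2\<bar> \<le> bed_variation ap ac am bp bm j"
    and "\<bar>bed_step bp bm j / 2 - am j * (b (j + 1) - b j)\<bar> \<le> bed_variation ap ac am bp bm j"
  unfolding bed_variation_def Let_def b_def jump_def by (rule Max_ge; simp)+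

text \<open>The end values are affine in the gradient, so a lower bound for each of the two blended
  reconstructions gives one for their convex combination.\<close>

lemma depth_end_values_ge:
  fixes x ap ac am G bp bm dbup h :: "int \<Rightarrow> real"
  assumes width: "0 < cell_width x j"
    and ap: "0 \<le> ap (j - 1)" and am: "0 \<le> am j" and alpha: "alpha_up ap am j < 1"
    and G: "0 < G j"
    and dbup: "bed_variation ap ac am bp bm j \<le> dbup j"
    and h: "0 \<le> h (j - 1)" "0 < h j" "0 \<le> h (j + 1)"
  defines "r \<equiv> depth_gradient x ap ac am G bp bm dbup h j"
  shows "(1 - alpha_up ap am j) * h j / (1 + G j) \<le> left_value x h r j"
    and "(1 - alpha_up ap am j) * h j / (1 + G j) \<le> right_value x h r j"
proof -
  define H where "H = depth_down ap am h j"
  define d where "d = dbup j"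
  define g where "g = blend (G j) (depth_bed_ratio H d)"
  define w where "w = cell_width x j / 2"
  define b where "b = bed_mean bp bm"
  define mh where "mh = w * slope_limiter x ap ac am h j"
  define me where "me = w * slope_limiter x ap ac am (surface bp bm h) j"
  define s where "s = me - bed_step bp bm j / 2"
  define L where "L = (1 - alpha_up ap am j) * h j / (1 + G j)"
  have H_ge: "(1 - alpha_up ap am j) * h j \<le> H"
    unfolding H_def using assms by (intro depth_down_ge) auto
  moreover have "0 < (1 - alpha_up ap am j) * h j"
    using alpha h by simp
  ultimately have "0 < H"
    by linarith
  moreover have "0 \<le> d"
    using abs_le_bed_variation(2)[where ap = ap and ac = ac and am = am
        and bp = bp and bm = bm and j = j] dbup
    unfolding d_def by linarith
  ultimately have g: "0 \<le> g" "g \<le> 1" "g * d \<le> H * G j / (1 + G j)"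
    unfolding g_def using G blend_times_bed_scale_le by blast+
  have L_le: "L \<le> H - g * d"
  proof -
    have "L \<le> H / (1 + G j)"
      unfolding L_def using H_ge G by (intro divide_right_mono) auto
    also have "H / (1 + G j) = H - H * G j / (1 + G j)"
      using G by (simp add: field_simps)
    finally show ?thesis
      using g by linarith
  qed
  note H_le = depth_down_le[where ap = ap and am = am and h = h and j = j, folded H_def]
  have depth_based: "H \<le> h j - mh" "H \<le> h j + mh"
    using half_cell_increment_bounds[where ap = ap and ac = ac and am = am and v = h, OF width] H_le
    unfolding mh_def w_def by linarith+
  \<comment> \<open>Each surface difference splits into a depth difference, which lowers the depth at most to
     \<open>H\<close>, and a bed difference, which combined with half the bed step has size at most \<open>d\<close>.\<close>
  have surface_based: "H - d \<le> h j - s" "H - d \<le> h j + s"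
  proof -
    have "ap (j - 1) * (surface bp bm h j - surface bp bm h (j - 1)) =
        ap (j - 1) * (h j - h (j - 1)) + ap (j - 1) * (b j - b (j - 1))"
      and "am j * (surface bp bm h (j + 1) - surface bp bm h j) =
        am j * (h (j + 1) - h j) + am j * (b (j + 1) - b j)"
      by (simp_all add: surface_def b_def algebra_simps)
    then show "H - d \<le> h j - s" "H - d \<le> h j + s"
      using half_cell_increment_bounds[where ap = ap and ac = ac and am = am
          and v = "surface bp bm h", OF width]
        abs_le_bed_variation[where ap = ap and ac = ac and am = am and bp = bp and bm = bm and j = j,
          folded b_def] dbup H_le
      unfolding s_def me_def w_def d_def by linarith+
  qed
  have incr: "w * r = (1 - g) * mh + g * s"
    using width
    by (simp add: r_def depth_gradient_def Let_def g_def H_def d_def mh_def s_def me_def w_def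
        bed_slope_def field_simps)
  have "H - g * d \<le> h j - w * r"
  proof -
    have "(1 - g) * H + g * (H - d) \<le> (1 - g) * (h j - mh) + g * (h j - s)"
      using g depth_based surface_based by (intro add_mono mult_left_mono) auto
    then show ?thesis
      unfolding incr by (simp add: algebra_simps)
  qed
  moreover have "H - g * d \<le> h j + w * r"
  proof -
    have "(1 - g) * H + g * (H - d) \<le> (1 - g) * (h j + mh) + g * (h j + s)"
      using g depth_based surface_based by (intro add_mono mult_left_mono) auto
    then show ?thesis
      unfolding incr by (simp add: algebra_simps)
  qed
  ultimately show "L \<le> left_value x h r j" "L \<le> right_value x h r j"
    using L_le unfolding left_value_def right_value_def w_def by linarith+
qed

section \<open>Upper bound for the flux\<close>

text \<open>A neighbouring depth multiplied by the factor is at most a multiple of \<open>h\<^sub>j\<close>.  In this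
  product form the bounds hold at a dry neighbour as well, where the ratio is infinite.\<close>

lemma flux_factor_bounds:
  fixes Kp Km h :: "int \<Rightarrow> real"
  assumes K: "0 < Kp (j - 1)" "0 < Km j"
    and h: "0 \<le> h (j - 1)" "0 < h j" "0 \<le> h (j + 1)"
  shows "0 \<le> flux_factor Kp Km h j" and "flux_factor Kp Km h j \<le> 1"
    and "flux_factor Kp Km h j * h (j - 1) \<le> Kp (j - 1) * h j"
    and "flux_factor Kp Km h j * h (j + 1) \<le> Km j * h j"
proof -
  define E where "E = Min {1, ereal (Kp (j - 1) * h j) / ereal (h (j - 1)),
      ereal (Km j * h j) / ereal (h (j + 1))}"
  have ratio: "0 \<le> ereal c / ereal k" if "0 < c" "0 \<le> k" for c k :: real
    using that by (cases "k = 0") (auto simp: zero_ereal_def[symmetric])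
  have cancel: "r * k \<le> c" if "ereal r \<le> ereal c / ereal k" "0 < c" "0 \<le> k" for r c k :: real
    using that by (cases "k = 0") (auto simp: field_simps)
  have c: "0 < Kp (j - 1) * h j" "0 < Km j * h j"
    using K h by simp_all
  have "0 \<le> E"
    unfolding E_def using ratio[OF c(1) h(1)] ratio[OF c(2) h(3)] by (intro Min.boundedI) auto
  have E_le: "E \<le> 1" "E \<le> ereal (Kp (j - 1) * h j) / ereal (h (j - 1))"
      "E \<le> ereal (Km j * h j) / ereal (h (j + 1))"
    unfolding E_def by (rule Min_le; simp)+
  obtain r where r: "E = ereal r"
    using \<open>0 \<le> E\<close> E_le(1) by (cases E) simp_all
  then have *: "flux_factor Kp Km h j = r"
    unfolding flux_factor_def E_def[symmetric] by simp
  show "0 \<le> flux_factor Kp Km h j" "flux_factor Kp Km h j \<le> 1"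
    using \<open>0 \<le> E\<close> E_le(1) by (simp_all add: * r)
  show "flux_factor Kp Km h j * h (j - 1) \<le> Kp (j - 1) * h j"
    unfolding * using E_le(2) c(1) h(1) unfolding r by (rule cancel)
  show "flux_factor Kp Km h j * h (j + 1) \<le> Km j * h j"
    unfolding * using E_le(3) c(2) h(3) unfolding r by (rule cancel)
qed

text \<open>Both ends of the cell are covered: \<open>m\<close> is the increment from the cell centre towards the
  end considered, and the index \<open>1\<close> marks the neighbour on that side.\<close>

lemma flux_end_value_le:
  fixes a k m q0 q1 h0 h1 u0 u1 K :: real
  assumes m: "min 0 (a * (q1 - q0)) \<le> m" "m \<le> max 0 (a * (q1 - q0))"
    and a: "0 \<le> a" "a \<le> 1" and k: "0 \<le> k" "k \<le> 1" "k * h1 \<le> K * h0"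
    and h: "0 \<le> h0" "0 \<le> h1" and q: "q0 = u0 * h0" "q1 = u1 * h1"
  shows "\<bar>q0 + k * m\<bar> \<le> h0 * (\<bar>u0\<bar> + K * a * \<bar>u1\<bar>)"
proof -
  have ka: "0 \<le> k * a" "k * a \<le> 1"
    using a k by (auto intro: mult_le_one)
  have "k * min 0 (a * (q1 - q0)) \<le> k * m" "k * m \<le> k * max 0 (a * (q1 - q0))"
    using m k by (simp_all add: mult_left_mono)
  then have km: "min 0 (k * a * (q1 - q0)) \<le> k * m" "k * m \<le> max 0 (k * a * (q1 - q0))"
    using k by (auto simp: min_def max_def mult.assoc split: if_splits)
  have "\<bar>q0 + k * a * (q1 - q0)\<bar> \<le> \<bar>q0\<bar> + k * a * \<bar>q1\<bar>"
  proof -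
    have "\<bar>(1 - k * a) * q0 + k * a * q1\<bar> \<le> (1 - k * a) * \<bar>q0\<bar> + k * a * \<bar>q1\<bar>"
      using ka abs_triangle_ineq[of "(1 - k * a) * q0" "k * a * q1"]
        abs_mult[of "1 - k * a" q0] abs_mult[of "k * a" q1]
      by simp
    also have "\<dots> \<le> 1 * \<bar>q0\<bar> + k * a * \<bar>q1\<bar>"
      using ka by (intro add_right_mono mult_right_mono) auto
    finally show ?thesis
      by (simp add: algebra_simps)
  qed
  moreover have "0 \<le> k * a * \<bar>q1\<bar>"
    using ka by simp
  ultimately have "\<bar>q0 + k * m\<bar> \<le> \<bar>q0\<bar> + k * a * \<bar>q1\<bar>"
    using km by linarith
  also have "k * a * \<bar>q1\<bar> = (k * h1) * (a * \<bar>u1\<bar>)"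
    using h q by (simp add: abs_mult)
  also have "\<dots> \<le> (K * h0) * (a * \<bar>u1\<bar>)"
    using k a by (intro mult_right_mono) auto
  also have "\<bar>q0\<bar> + (K * h0) * (a * \<bar>u1\<bar>) = h0 * (\<bar>u0\<bar> + K * a * \<bar>u1\<bar>)"
    using h q by (simp add: abs_mult algebra_simps)
  finally show ?thesis
    by simp
qed

section \<open>Bound for the velocities\<close>

lemma velocity_le:
  fixes A G h0 hE qE V :: real
  assumes "0 < A" "0 < G" "0 < h0" "A * h0 / (1 + G) \<le> hE" "\<bar>qE\<bar> \<le> h0 * V"
  shows "\<bar>qE / hE\<bar> \<le> (G + 1) / A * V"
proof -
  have L: "0 < A * h0 / (1 + G)"
    using assms by simp
  have "\<bar>qE / hE\<bar> = \<bar>qE\<bar> / hE"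
    using L assms(4) by simp
  also have "\<dots> \<le> h0 * V / (A * h0 / (1 + G))"
    using assms L by (intro frac_le) auto
  also have "\<dots> = (G + 1) / A * V"
    using assms by (simp add: field_simps)
  finally show ?thesis .
qed

theorem theorem4p2:
  fixes J j :: int
    and x ap ac am G Kp Km bp bm dbup h q u :: "int \<Rightarrow> real"
    and hx qx hL hR qL qR uL uR :: real
  assumes grid: "strict_mono_on {0..J} x"
    and j_interior: "2 \<le> j" "j + 1 \<le> J"
    and alpha_p: "ap (j - 1) \<in> {0..1}"
    and alpha_c: "ac j \<in> {0..1}"
    and alpha_m: "am j \<in> {0..1}"
    and G_bounds: "0 < G j" "G j \<le> 1 - alpha_up ap am j"
    and K_pos: "0 < Kp (j - 1)" "0 < Km j"
    and dbup: "bed_variation ap ac am bp bm j \<le> dbup j"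
    and h_nonneg: "\<And>k. k \<in> {1..J} \<Longrightarrow> 0 \<le> h k"
    and flux: "\<And>k. k \<in> {1..J} \<Longrightarrow> q k = u k * h k"
    and h_pos: "0 < h j"
    and hx: "hx = depth_gradient x ap ac am G bp bm dbup h j"
    and qx: "qx = flux_gradient x ap ac am Kp Km h q j"
    and hL: "hL = left_value x h hx j" and hR: "hR = right_value x h hx j"
    and qL: "qL = left_value x q qx j" and qR: "qR = right_value x q qx j"
    and uL: "uL = qL / hL" and uR: "uR = qR / hR"
  shows "hL \<noteq> 0 \<and> hR \<noteq> 0 \<and>
    \<bar>uL\<bar> \<le> (G j + 1) / (1 - alpha_up ap am j) *
      (\<bar>u j\<bar> + Kp (j - 1) * ap (j - 1) * \<bar>u (j - 1)\<bar>) \<and>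
    \<bar>uR\<bar> \<le> (G j + 1) / (1 - alpha_up ap am j) *
      (\<bar>u j\<bar> + Km j * am j * \<bar>u (j + 1)\<bar>)"
proof -
  define A where "A = 1 - alpha_up ap am j"
  define k where "k = flux_factor Kp Km h j"
  define m where "m = cell_width x j / 2 * slope_limiter x ap ac am q j"
  have width: "0 < cell_width x j"
    using strict_mono_onD[OF grid, of "j - 1" j] j_interior by (simp add: cell_width_def)
  have h: "0 \<le> h (j - 1)" "0 \<le> h (j + 1)"
    using h_nonneg j_interior by simp_all
  have q: "q (j - 1) = u (j - 1) * h (j - 1)" "q j = u j * h j" "q (j + 1) = u (j + 1) * h (j + 1)"
    using flux j_interior by simp_all
  have A: "0 < A"
    using G_bounds by (simp add: A_def)
  have depth: "A * h j / (1 + G j) \<le> hL" "A * h j / (1 + G j) \<le> hR"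
    using depth_end_values_ge[where h = h and G = G and dbup = dbup, OF width _ _ _ _ dbup]
      alpha_p alpha_m G_bounds h h_pos A
    unfolding hL hR hx A_def by auto
  moreover have "0 < A * h j / (1 + G j)"
    using A h_pos G_bounds by simp
  ultimately have nonzero: "hL \<noteq> 0" "hR \<noteq> 0"
    by linarith+
  have k: "0 \<le> k" "k \<le> 1" "k * h (j - 1) \<le> Kp (j - 1) * h j" "k * h (j + 1) \<le> Km j * h j"
    unfolding k_def using flux_factor_bounds K_pos h h_pos by blast+
  note m_bounds = half_cell_increment_bounds[where ap = ap and ac = ac and am = am and v = q,
      OF width, folded m_def]
  have "\<bar>q j + k * (- m)\<bar> \<le> h j * (\<bar>u j\<bar> + Kp (j - 1) * ap (j - 1) * \<bar>u (j - 1)\<bar>)"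
  proof (rule flux_end_value_le[OF _ _ _ _ k(1,2,3) _ h(1) q(2,1)])
    \<comment> \<open>Towards the left the increment and the difference both change sign.\<close>
    have "ap (j - 1) * (q (j - 1) - q j) = - (ap (j - 1) * (q j - q (j - 1)))"
      by (simp add: algebra_simps)
    then show "min 0 (ap (j - 1) * (q (j - 1) - q j)) \<le> - m"
      "- m \<le> max 0 (ap (j - 1) * (q (j - 1) - q j))"
      using m_bounds(1,2) by linarith+
  qed (use alpha_p h_pos in auto)
  then have qL_le: "\<bar>qL\<bar> \<le> h j * (\<bar>u j\<bar> + Kp (j - 1) * ap (j - 1) * \<bar>u (j - 1)\<bar>)"
    by (simp add: qL qx left_value_def flux_gradient_def k_def m_def mult.left_commute)
  have "\<bar>q j + k * m\<bar> \<le> h j * (\<bar>u j\<bar> + Km j * am j * \<bar>u (j + 1)\<bar>)"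
    by (rule flux_end_value_le[OF m_bounds(3,4) _ _ k(1,2,4) _ h(2) q(2,3)])
      (use alpha_m h_pos in auto)
  then have qR_le: "\<bar>qR\<bar> \<le> h j * (\<bar>u j\<bar> + Km j * am j * \<bar>u (j + 1)\<bar>)"
    by (simp add: qR qx right_value_def flux_gradient_def k_def m_def mult.left_commute)
  show ?thesis
    unfolding uL uR A_def[symmetric]
    using nonzero velocity_le[OF A G_bounds(1) h_pos depth(1) qL_le]
      velocity_le[OF A G_bounds(1) h_pos depth(2) qR_le]
    by blast
qed

end
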